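(* Let $n\ge1$. The map $\zeta_C:\mathcal L_{n,n}\to\mathcal B_n$ is a bijection, and $\operatorname{dinv}(\pi)=\operatorname{area}(\zeta_C(\pi))$ for every $\pi\in\mathcal L_{n,n}$.
   Context: $\mathcal L_{n,n}$: lattice paths from $(0,0)$ to $(n,n)$ with steps $N=(0,1)$, $E=(1,0)$. $\mathcal B_n$: ballot paths, i.e. lattice paths from $(0,0)$ with $2n$ steps in $\{N,E\}$ never going below the line $x=y$. Type $C$ area vector of $\pi\in\mathcal L_{n,n}$: $(a_1,\dots,a_n)$ with $a_i=i-b_i$, where $b_i$ is the $x$-coordinate of the $i$-th North step of $\pi$ (the number of boxes in row $i$ to the left of $\pi$). Define $\operatorname{dinv}(\pi)=\#\{(i,j):i<j,a_i=a_j\}+\#\{(i,j):i<j,a_i=a_j+1\}+\#\{(i,j):i<j,a_i=-a_j\}+\#\{(i,j):i<j,a_i=-a_j+1\}+\#\{i:a_i=0\}$ (a pair may be counted in several terms). The map $\zeta_C$: given $\pi$ with area vector $(a_1,\dots,a_n)$, start at $(0,0)$ with $i=n$; read the area vector from left to right, drawing an East step for each entry equal to $-i-1$ and a North step for each entry equal to $-i$; then read it from right to left, drawing an East step for each entry equal to $i+1$ and a North step for each entry equal to $i$; then replace $i$ by $i-1$ and repeat, stopping as soon as $2n$ steps have been drawn; $\zeta_C(\pi)$ is the resulting path. Area of a ballot path $\beta\in\mathcal B_n$: index columns and rows by $1,\dots,2n$ (column $i$ is $[i-1,i]\times\mathbb R$, row $j$ is $\mathbb R\times[j-1,j]$); $\operatorname{area}(\beta)$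 is the number of pairs $(i,j)$ with $1\le i<j$, $i+j\le 2n+1$, such that $\beta$ has at least $j$ North steps and its $j$-th North step has $x$-coordinate at most $i-1$ (i.e. the number of boxes of the staircase region $\{i<j,\ i+j\le 2n+1\}$ lying below/right of $\beta$). *)

theory Defs
  imports Main
begin

datatype step = North | East

text \<open>A path starting at the origin is the list of its steps.\<close>

type_synonym path = "step list"

definition lattice_paths :: "nat \<Rightarrow> path set" where
  "lattice_paths n = {\<pi>. count_list \<pi> North = n \<and> count_list \<pi> East = n}"

text \<open>After the first \<open>k\<close> steps the path is at the point whose \<open>x\<close>- and \<open>y\<close>-coordinates are
  the numbers of East and North steps among them.\<close>

definition ballot_paths :: "nat \<Rightarrow> path set" where
  "ballot_paths n = {\<beta>. length \<beta> = 2 * n \<and>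
     (\<forall>k \<le> length \<beta>. count_list (take k \<beta>) East \<le> count_list (take k \<beta>) North)}"

text \<open>\<open>north_xs x \<pi>\<close> lists the \<open>x\<close>-coordinates of the North steps of \<open>\<pi>\<close>, in order, when \<open>\<pi>\<close>
  starts at abscissa \<open>x\<close>.\<close>

fun north_xs :: "nat \<Rightarrow> path \<Rightarrow> nat list" where
  "north_xs x [] = []"
| "north_xs x (North # \<pi>) = x # north_xs x \<pi>"
| "north_xs x (East # \<pi>) = north_xs (Suc x) \<pi>"

text \<open>Lists are indexed from 0, so the \<open>i\<close>-th entry of the area vector, \<open>1 \<le> i\<close>, is
  \<open>area_vector \<pi> ! (i - 1)\<close>.\<close>

definition area_vector :: "path \<Rightarrow> int list" where
  "area_vector \<pi> = (let b = north_xs 0 \<pi> in map (\<lambda>k. int (Suc k) - int (b ! k)) [0..<length b])"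

definition dinv :: "path \<Rightarrow> nat" where
  "dinv \<pi> = (let a = area_vector \<pi>; n = length a in
      card {(i, j). i < j \<and> j < n \<and> a ! i = a ! j}
    + card {(i, j). i < j \<and> j < n \<and> a ! i = a ! j + 1}
    + card {(i, j). i < j \<and> j < n \<and> a ! i = - (a ! j)}
    + card {(i, j). i < j \<and> j < n \<and> a ! i = - (a ! j) + 1}
    + card {i. i < n \<and> a ! i = 0})"

text \<open>\<open>draw e m a\<close> reads \<open>a\<close> from left to right, drawing an East step for each entry \<open>e\<close> and a North
  step for each entry \<open>m\<close>.\<close>

definition draw :: "int \<Rightarrow> int \<Rightarrow> int list \<Rightarrow> path" where
  "draw e m a = concat (map (\<lambda>x. if x = e then [East] else if x = m then [North] else []) a)"

definition zeta_round :: "int list \<Rightarrow> int \<Rightarrow> path" where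
  "zeta_round a i = draw (- i - 1) (- i) a @ draw (i + 1) i (rev a)"

definition zeta_rounds :: "nat \<Rightarrow> int list \<Rightarrow> path" where
  "zeta_rounds n a = concat (map (\<lambda>i. zeta_round a (int i)) (rev [0..<Suc n]))"

text \<open>Stopping after \<open>2 * n\<close> steps is the \<open>take\<close>. The rounds \<open>i = n, \<dots>, 0\<close> are enough: by
  \<open>length_zeta_rounds\<close> below they draw exactly \<open>2 * n\<close> steps.\<close>

definition zeta_C :: "nat \<Rightarrow> path \<Rightarrow> path" where
  "zeta_C n \<pi> = take (2 * n) (zeta_rounds n (area_vector \<pi>))"

definition ballot_area :: "nat \<Rightarrow> path \<Rightarrow> nat" where
  "ballot_area n \<beta> = (let b = north_xs 0 \<beta> in
     card {(i, j). 1 \<le> i \<and> i < j \<and> i + j \<le> 2 * n + 1 \<and> j \<le> length b \<and> b ! (j - 1) \<le> i - 1})"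

lemma length_north_xs: "length (north_xs x \<pi>) = count_list \<pi> North"
  by (induction x \<pi> rule: north_xs.induct) auto

lemma north_xs_le: "b \<in> set (north_xs x \<pi>) \<Longrightarrow> b \<le> x + count_list \<pi> East"
  by (induction x \<pi> rule: north_xs.induct) auto

lemma area_vector_bounds:
  assumes "\<pi> \<in> lattice_paths n" and "x \<in> set (area_vector \<pi>)"
  shows "\<bar>x\<bar> \<le> int n"
proof -
  obtain k where k: "k < length (north_xs 0 \<pi>)" "x = int (Suc k) - int (north_xs 0 \<pi> ! k)"
    using assms(2) by (auto simp: area_vector_def Let_def)
  have "north_xs 0 \<pi> ! k \<le> n"
    using north_xs_le[of "north_xs 0 \<pi> ! k" 0 \<pi>] k(1) assms(1) by (simp add: lattice_paths_def)
  moreover have "k < n"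
    using k(1) assms(1) by (simp add: length_north_xs lattice_paths_def)
  ultimately show ?thesis using k(2) by linarith
qed

lemma length_draw_single: "length (draw e m [x]) = (if x = e \<or> x = m then 1 else 0)"
  by (simp add: draw_def)

lemma length_draw_Cons: "length (draw e m (x # a)) = length (draw e m [x]) + length (draw e m a)"
  by (simp add: draw_def)

lemma length_draw_rev: "length (draw e m (rev a)) = length (draw e m a)"
  by (induction a) (simp_all add: draw_def)

lemma length_zeta_rounds_sum:
  "length (zeta_rounds n a) =
     (\<Sum>i\<le>n. length (draw (- int i - 1) (- int i) a) + length (draw (int i + 1) (int i) a))"
  by (induction n) (simp_all add: zeta_rounds_def zeta_round_def length_draw_rev)

lemma length_zeta_rounds_single:
  assumes "\<bar>x\<bar> \<le> int n"
  shows "length (zeta_rounds n [x]) = 2"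
proof -
  obtain k where k: "x = int k \<or> x = - int k" and "k \<le> n"
    using assms by (cases x rule: int_cases2) auto
  have summand: "length (draw (- int i - 1) (- int i) [x]) + length (draw (int i + 1) (int i) [x]) =
      (if k = i then 1 else 0) + (if k = Suc i then 1 else 0) + (if k = 0 \<and> i = 0 then 1 else 0)"
    for i
    unfolding length_draw_single using k by (elim disjE; cases "k = i"; cases "k = Suc i") auto
  have "(\<Sum>i\<le>n. (if k = i then 1 else 0) + (if k = Suc i then 1 else 0) +
      (if k = 0 \<and> i = 0 then 1 else 0)) = (2 :: nat)"
    using \<open>k \<le> n\<close> by (cases k) (simp_all add: sum.distrib)
  then show ?thesis unfolding length_zeta_rounds_sum summand .
qed

lemma length_zeta_rounds:
  assumes "\<pi> \<in> lattice_paths n"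
  shows "length (zeta_rounds n (area_vector \<pi>)) = 2 * n"
proof -
  have cons: "length (zeta_rounds n (x # a)) = length (zeta_rounds n [x]) + length (zeta_rounds n a)"
    for x a
    unfolding length_zeta_rounds_sum length_draw_Cons[of _ _ x a] sum.distrib
    by (simp only: ac_simps)
  have "length (zeta_rounds n a) = 2 * length a" if "\<forall>x \<in> set a. \<bar>x\<bar> \<le> int n" for a
    using that
  proof (induction a)
    case Nil
    show ?case by (simp add: length_zeta_rounds_sum draw_def)
  next
    case (Cons x a)
    then show ?case using cons[of x a] by (simp add: length_zeta_rounds_single)
  qed
  moreover have "length (area_vector \<pi>) = n"
    using assms by (simp add: area_vector_def Let_def length_north_xs lattice_paths_def)
  ultimately show ?thesis using area_vector_bounds[OF assms] by simp
qed

end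

theory Submission
  imports Defs
begin

text \<open>
  Entries of an area vector rise by at most 1 at a time, the first is at most 1 and the last is
  nonnegative. Hence every half-round of \<open>\<zeta>\<close> except the last is empty or ends with a North step,
  so each half-round is the longest remaining suffix with a given number of North steps. That number
  is known when decoding backwards: the final height of the path is twice the number of zeros, and the
  East steps of a half-round count the North steps of the corresponding half of the previous round.
  Decoding yields, for every \<open>v\<close>, the subword of entries \<open>v\<close> and \<open>v + 1\<close>, and these subwords
  determine a sequence with rises at most 1. So \<open>\<zeta>\<close> is injective; surjectivity follows
  since ballot paths of length \<open>2n\<close> and lattice paths to \<open>(n, n)\<close> are equinumerous.

  The area is the sum of (height - 1) over the East steps, plus \<open>z\<^sup>2\<close> for the triangle of columns to
  the right of the endpoint, where \<open>z\<close> is the number of zeros. At the start of a half-round the height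
  is the sum of two multiplicities of entries, which turns the contribution of each round into pairs
  counted by dinv.
\<close>

section \<open>Counting ballot paths\<close>

text \<open>The first argument is the height above the diagonal. A variable starting height makes
  the count provable by induction on the first step.\<close>

fun stays :: "nat \<Rightarrow> path \<Rightarrow> bool" where
  "stays h [] = True"
| "stays h (North # p) = stays (Suc h) p"
| "stays h (East # p) = (h \<ge> 1 \<and> stays (h - 1) p)"

lemma all_le_Suc_iff: "(\<forall>k \<le> Suc n. P k) \<longleftrightarrow> P 0 \<and> (\<forall>k \<le> n. P (Suc k))"
  using All_less_Suc2[of "Suc n" P] by (simp add: less_Suc_eq_le)

lemma stays_iff_prefixes:
  "stays h p \<longleftrightarrow> (\<forall>k \<le> length p. count_list (take k p) East \<le> h + count_list (take k p) North)"
proof (induction h p rule: stays.induct)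
  case (2 h p)
  then show ?case by (simp add: all_le_Suc_iff)
next
  case (3 h p)
  then show ?case by (cases h) (auto simp: all_le_Suc_iff)
qed auto

lemma ballot_paths_eq_stays: "ballot_paths n = {p. length p = 2 * n \<and> stays 0 p}"
  by (simp add: ballot_paths_def stays_iff_prefixes)

definition net :: "path \<Rightarrow> int" where
  "net p = int (count_list p North) - int (count_list p East)"

lemma net_simps [simp]:
  "net [] = 0" "net (North # p) = net p + 1" "net (East # p) = net p - 1"
  "net (p @ q) = net p + net q"
  by (simp_all add: net_def)

lemma length_eq_count_steps: "length p = count_list p North + count_list p East"
proof (induction p)
  case (Cons s p)
  then show ?case by (cases s) auto
qed simp

lemma finite_paths_length: "finite {p :: path. length p = m \<and> Q p}"
proof -
  have "(UNIV :: step set) = {North, East}" using step.exhaust by blast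
  then have "finite (UNIV :: step set)" by (metis finite.emptyI finite.insertI)
  from finite_lists_length_eq[OF this, of m] show ?thesis by (rule rev_finite_subset) auto
qed

lemma card_paths_first_step:
  "card {p. length p = Suc m \<and> Q p} =
     card {p. length p = m \<and> Q (North # p)} + card {p. length p = m \<and> Q (East # p)}"
proof -
  have "{p. length p = Suc m \<and> Q p} =
      Cons North ` {p. length p = m \<and> Q (North # p)} \<union> Cons East ` {p. length p = m \<and> Q (East # p)}"
    (is "?L = ?R")
  proof
    show "?L \<subseteq> ?R"
    proof
      fix p assume "p \<in> ?L"
      then obtain s q where "p = s # q" "length q = m" "Q p" by (cases p) auto
      then show "p \<in> ?R" by (cases s) auto
    qed
  qed auto
  moreover have "card ?R = card {p. length p = m \<and> Q (North # p)} + card {p. length p = m \<and> Q (East # p)}"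
    by (subst card_Un_disjoint) (auto simp: finite_paths_length card_image)
  ultimately show ?thesis by simp
qed

text \<open>The window of end heights is what the reflection principle leaves; the induction
  replaces the reflection by an inclusion-exclusion of two shifted windows.\<close>

lemma card_stays:
  "card {p. length p = m \<and> stays h p} =
   card {p. length p = m \<and> - int h \<le> net p \<and> net p \<le> int h + 1}"
proof (induction m arbitrary: h)
  case 0
  have "{p :: path. length p = 0 \<and> stays h p} = {[]}"
    and "{p. length p = 0 \<and> - int h \<le> net p \<and> net p \<le> int h + 1} = {[]}" by auto
  then show ?case by simp
next
  case (Suc m)
  define W where "W l u = {p. length p = m \<and> l \<le> net p \<and> net p \<le> u}" for l u
  have fin: "finite (W l u)" for l u unfolding W_def by (rule finite_paths_length)
  have "card {p. length p = Suc m \<and> - int h \<le> net p \<and> net p \<le> int h + 1} =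
      card (W (- int h - 1) (int h)) + card (W (- int h + 1) (int h + 2))"
    unfolding card_paths_first_step W_def
    by (intro arg_cong2[of _ _ _ _ "(+)"] arg_cong[of _ _ card]) auto
  also have "\<dots> = card (W (- int h - 1) (int h) \<union> W (- int h + 1) (int h + 2))
      + card (W (- int h - 1) (int h) \<inter> W (- int h + 1) (int h + 2))"
    by (rule card_Un_Int) (rule fin)+
  \<comment> \<open>For \<open>h = 0\<close> the two windows are only adjacent, which leaves no gap
    among integers.\<close>
  also have "W (- int h - 1) (int h) \<union> W (- int h + 1) (int h + 2) = W (- int (Suc h)) (int (Suc h) + 1)"
    unfolding W_def by auto
  also have "W (- int h - 1) (int h) \<inter> W (- int h + 1) (int h + 2) = W (- int h + 1) (int h)"
    unfolding W_def by auto
  also have "card (W (- int (Suc h)) (int (Suc h) + 1)) = card {p. length p = m \<and> stays (Suc h) p}"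
    unfolding W_def Suc.IH ..
  also have "card (W (- int h + 1) (int h)) = card {p. length p = m \<and> stays h (East # p)}"
  \<comment> \<open>At height 0 an East step is forbidden; correspondingly the windows do not
    overlap.\<close>
  proof (cases h)
    case 0
    then have "W (- int h + 1) (int h) = {}" by (auto simp: W_def)
    then show ?thesis using 0 by simp
  next
    case (Suc k)
    then show ?thesis using Suc.IH[of k] by (simp add: W_def add.commute)
  qed
  finally show ?case by (simp add: card_paths_first_step)
qed

lemma card_ballot_paths: "card (ballot_paths n) = card (lattice_paths n)"
proof -
  \<comment> \<open>The window is {0, 1}, and even length excludes a net height of 1.\<close>
  have "{p. length p = 2 * n \<and> - int 0 \<le> net p \<and> net p \<le> int 0 + 1} = lattice_paths n"
    unfolding lattice_paths_def net_def length_eq_count_steps by auto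
  then show ?thesis unfolding ballot_paths_eq_stays card_stays by simp
qed

section \<open>Drawing subwords\<close>

lemma count_draw_East [simp]: "count_list (draw e m a) East = count_list a e"
  by (induction a) (auto simp: draw_def)

lemma count_draw_North [simp]: "e \<noteq> m \<Longrightarrow> count_list (draw e m a) North = count_list a m"
  by (induction a) (auto simp: draw_def)

lemma draw_eq_map_filter:
  "draw e m a = map (\<lambda>x. if x = e then East else North) (filter (\<lambda>x. x = e \<or> x = m) a)"
  by (induction a) (auto simp: draw_def)

lemma draw_eqD:
  assumes "draw e m a = draw e m b" and "e \<noteq> m"
  shows "filter (\<lambda>x. x = e \<or> x = m) a = filter (\<lambda>x. x = e \<or> x = m) b"
  using assms unfolding draw_eq_map_filter
  by (elim map_inj_on) (auto simp: inj_on_def split: if_splits)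

lemma count_list_rev [simp]: "count_list (rev xs) x = count_list xs x"
  by (induction xs) auto

section \<open>The rounds of zeta never go below the diagonal\<close>

lemma zeta_rounds_0: "zeta_rounds 0 a = zeta_round a 0"
  by (simp add: zeta_rounds_def)

lemma zeta_rounds_Suc: "zeta_rounds (Suc n) a = zeta_round a (int (Suc n)) @ zeta_rounds n a"
  by (simp add: zeta_rounds_def)

text \<open>The truncation by \<open>nat\<close> is harmless, since \<open>stays h p\<close> forces
  \<open>int h + net p\<close> to be nonnegative.\<close>

lemma stays_append: "stays h (p @ q) \<longleftrightarrow> stays h p \<and> stays (nat (int h + net p)) q"
proof (induction h p rule: stays.induct)
  case (3 h p)
  then show ?case by (cases h) (auto simp: algebra_simps)
qed (auto simp: algebra_simps)

lemma stays_if_count_East_le: "count_list p East \<le> h \<Longrightarrow> stays h p"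
  by (induction h p rule: stays.induct) auto

lemma net_zeta_round:
  "net (zeta_round a i) = int (count_list a i) + int (count_list a (- i))
     - int (count_list a (i + 1)) - int (count_list a (- i - 1))"
  by (simp add: zeta_round_def net_def)

text \<open>The starting height is the total number of East steps in the round. The second half
  starts at \<open>count_list a (i + 1) + count_list a (- i)\<close>, which again covers its own
  East steps.\<close>

lemma stays_zeta_round:
  "stays (count_list a (i + 1) + count_list a (- i - 1)) (zeta_round a i)"
  unfolding zeta_round_def stays_append
  by (auto intro!: stays_if_count_East_le simp: net_def)

lemma minus_int_Suc: "- int (Suc n) = - int n - 1"
  by simp

text \<open>Round \<open>i\<close> ends at height
  \<open>count_list a i + count_list a (- i)\<close>, exactly where round \<open>i - 1\<close> is
  supposed to start.\<close>

lemma stays_zeta_rounds: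
  "stays (count_list a (int n + 1) + count_list a (- int n - 1)) (zeta_rounds n a)"
proof (induction n)
  case 0
  then show ?case using stays_zeta_round[of a 0] by (simp add: zeta_rounds_0)
next
  case (Suc n)
  have eq: "nat (int (count_list a (int (Suc n) + 1) + count_list a (- int (Suc n) - 1))
        + net (zeta_round a (int (Suc n))))
      = count_list a (int n + 1) + count_list a (- int n - 1)"
    unfolding net_zeta_round minus_int_Suc by (simp add: add.commute nat_int_add)
  show ?case
    unfolding zeta_rounds_Suc stays_append eq using Suc.IH stays_zeta_round by blast
qed

section \<open>Area vectors\<close>

abbreviation slow :: "int list \<Rightarrow> bool" where
  "slow \<equiv> successively (\<lambda>x y. y \<le> x + 1)"

lemma north_xs_ge: "b \<in> set (north_xs x p) \<Longrightarrow> x \<le> b"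
  by (induction x p rule: north_xs.induct) auto

lemma sorted_north_xs: "sorted (north_xs x p)"
  by (induction x p rule: north_xs.induct) (auto dest: north_xs_ge)

text \<open>The abscissas do not see the East steps after the last North step; the second assumption
  supplies them.\<close>

lemma north_xs_inject:
  assumes "north_xs x p = north_xs x q" and "count_list p East = count_list q East"
  shows "p = q"
  using assms
proof (induction x p arbitrary: q rule: north_xs.induct)
  case (1 x)
  then have "count_list q North = 0" using length_north_xs[of x q] by simp
  then show ?case using 1 length_eq_count_steps[of q] by simp
next
  case (2 x p)
  then obtain s r where q: "q = s # r" by (cases q) auto
  have "s \<noteq> East"
  proof
    assume "s = East"
    then have "x \<in> set (north_xs (Suc x) r)" using 2(2) q by (metis list.set_intros(1) north_xs.simps(2,3))
    then show False using north_xs_ge by fastforce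
  qed
  then have "s = North" by (cases s) auto
  then show ?case using 2 q by simp
next
  case (3 x p)
  then obtain s r where q: "q = s # r" by (cases q) auto
  have "s \<noteq> North"
  proof
    assume "s = North"
    then have "x \<in> set (north_xs (Suc x) p)" using 3(2) q by simp
    then show False using north_xs_ge by fastforce
  qed
  then have "s = East" by (cases s) auto
  then show ?case using 3 q by simp
qed

lemma length_area_vector: "\<pi> \<in> lattice_paths n \<Longrightarrow> length (area_vector \<pi>) = n"
  by (simp add: area_vector_def Let_def length_north_xs lattice_paths_def)

lemma area_vector_nth:
  "k < length (area_vector \<pi>) \<Longrightarrow> area_vector \<pi> ! k = int (Suc k) - int (north_xs 0 \<pi> ! k)"
  by (simp add: area_vector_def Let_def)

lemma inj_on_area_vector: "inj_on area_vector (lattice_paths n)"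
proof (rule inj_onI)
  fix p q assume p: "p \<in> lattice_paths n" and q: "q \<in> lattice_paths n"
    and eq: "area_vector p = area_vector q"
  have "north_xs 0 p = north_xs 0 q"
  proof (rule nth_equalityI)
    show "length (north_xs 0 p) = length (north_xs 0 q)"
      using p q by (simp add: length_north_xs lattice_paths_def)
    fix k assume "k < length (north_xs 0 p)"
    then have "k < n" using p by (simp add: length_north_xs lattice_paths_def)
    then show "north_xs 0 p ! k = north_xs 0 q ! k"
      using area_vector_nth[of k p] area_vector_nth[of k q] eq length_area_vector[OF p]
        length_area_vector[OF q] by simp
  qed
  then show "p = q" using p q by (intro north_xs_inject[of 0]) (auto simp: lattice_paths_def)
qed

text \<open>The sentinels 0 and 1 express that the first entry is at most 1 and the last is nonnegative.\<close>

lemma slow_area_vector: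
  assumes "\<pi> \<in> lattice_paths n"
  shows "slow (0 # area_vector \<pi> @ [1])"
proof -
  let ?a = "area_vector \<pi>" and ?b = "north_xs 0 \<pi>"
  have len: "length ?a = n" "length ?b = n"
    using assms by (simp_all add: length_area_vector length_north_xs lattice_paths_def)
  have "slow ?a"
    unfolding successively_conv_nth
  proof (intro allI impI)
    fix k assume k: "Suc k < length ?a"
    then have "?b ! k \<le> ?b ! Suc k" using sorted_nth_mono[OF sorted_north_xs] len by simp
    then show "?a ! Suc k \<le> ?a ! k + 1" using k by (simp add: area_vector_nth)
  qed
  moreover have "hd ?a \<le> 1" if "?a \<noteq> []"
    using that by (simp add: hd_conv_nth area_vector_nth)
  moreover have "0 \<le> last ?a" if "?a \<noteq> []"
  proof -
    have "?b ! (n - 1) \<le> n"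
      using north_xs_le[OF nth_mem, of "n - 1" 0 \<pi>] that len assms
      by (cases n) (auto simp: lattice_paths_def)
    then show ?thesis using that len by (cases n) (auto simp: last_conv_nth area_vector_nth)
  qed
  ultimately show ?thesis
    by (cases ?a)
      (auto simp: successively_append_iff successively_Cons hd_append split: if_splits)
qed

section \<open>Injectivity\<close>

text \<open>With rises of at most 1, a word starting below \<open>y\<close> must visit
  \<open>y - 1\<close> before it reaches \<open>y\<close>.\<close>

lemma slow_hd_filter:
  assumes "slow (x # s)" and "y \<in> set (x # s)" and "x < y"
  shows "hd (filter (\<lambda>w. w = y - 1 \<or> w = y) (x # s)) = y - 1"
  using assms
proof (induction s arbitrary: x)
  case (Cons x' s)
  then show ?case by (cases "x = y - 1") (auto simp: successively_Cons)
qed auto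

lemma slow_eq_if_adjacent_filters_eq:
  assumes "\<And>v. filter (\<lambda>w. w = v \<or> w = v + 1) a = filter (\<lambda>w. w = v \<or> w = v + 1) b"
    and "slow a" and "slow b"
  shows "a = b"
  using assms
proof (induction a arbitrary: b)
  case Nil
  show ?case
  proof (cases b)
    case (Cons y t)
    then show ?thesis using Nil(1)[of y] by simp
  qed simp
next
  case (Cons x s)
  obtain y t where b: "b = y # t" using Cons.prems(1)[of x] by (cases b) auto
  \<comment> \<open>If the first entries were \<open>x < y\<close>, the subword on
    \<open>y - 1\<close> and \<open>y\<close> would start with \<open>y - 1\<close> in one word and
    with \<open>y\<close> in the other.\<close>
  have no_ascent: False
    if "slow (x # s)" "x < y"
      "\<And>v. filter (\<lambda>w. w = v \<or> w = v + 1) (x # s) = filter (\<lambda>w. w = v \<or> w = v + 1) (y # t)"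
    for x y :: int and s t
  proof -
    have eq: "filter (\<lambda>w. w = y - 1 \<or> w = y) (x # s) = y # filter (\<lambda>w. w = y - 1 \<or> w = y) t"
      using that(3)[of "y - 1"] by simp
    then have "y \<in> set (filter (\<lambda>w. w = y - 1 \<or> w = y) (x # s))" by (metis list.set_intros(1))
    then have "y \<in> set (x # s)" by (metis filter_is_subset subsetD)
    from slow_hd_filter[OF that(1) this that(2)] show False unfolding eq by simp
  qed
  have "\<not> x < y" using no_ascent[of x s y t] Cons.prems b by blast
  moreover have "\<not> y < x" using no_ascent[of y t x s] Cons.prems b by metis
  ultimately have "x = y" by simp
  moreover have "s = t"
  proof (rule Cons.IH)
    show "filter (\<lambda>w. w = v \<or> w = v + 1) s = filter (\<lambda>w. w = v \<or> w = v + 1) t" for v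
      using Cons.prems(1)[of v] b \<open>x = y\<close> by (simp split: if_splits)
    show "slow s" "slow t" using Cons.prems b by (auto simp: successively_Cons)
  qed
  ultimately show ?case using b by simp
qed

definition ends_North :: "path \<Rightarrow> bool" where
  "ends_North p \<longleftrightarrow> p = [] \<or> last p = North"

lemma ends_North_append: "ends_North p \<Longrightarrow> ends_North q \<Longrightarrow> ends_North (p @ q)"
  by (auto simp: ends_North_def last_append)

lemma all_East: "count_list p North = 0 \<Longrightarrow> s \<in> set p \<Longrightarrow> s = East"
  by (cases s) (auto simp: count_list_0_iff)

text \<open>The two cuts differ by a word \<open>W\<close> without North steps that ends one of the
  prefixes. A nonempty \<open>W\<close> would make that prefix end with East.\<close>

lemma peel_suffix:
  assumes "U @ V = U' @ V'" and "count_list V North = count_list V' North"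
    and "ends_North U" and "ends_North U'"
  shows "U = U' \<and> V = V'"
proof -
  have empty: "W = []" if "count_list W North = 0" "ends_North (X @ W)" for W X
  proof (rule ccontr)
    assume "W \<noteq> []"
    then have "last W = East" using all_East[OF that(1)] by simp
    then show False using that(2) \<open>W \<noteq> []\<close> by (simp add: ends_North_def)
  qed
  from assms(1) obtain W where "U = U' @ W \<and> W @ V = V' \<or> U @ W = U' \<and> V = W @ V'"
    by (auto simp: append_eq_append_conv2)
  then show ?thesis
  proof
    assume W: "U = U' @ W \<and> W @ V = V'"
    then have "W = []" using assms(2,3) by (intro empty[of W U']) auto
    then show ?thesis using W by simp
  next
    assume W: "U @ W = U' \<and> V = W @ V'"
    then have "W = []" using assms(2,4) by (intro empty[of W U]) auto
    then show ?thesis using W by simp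
  qed
qed

text \<open>The last step drawn comes from the first entry of \<open>a\<close> equal to
  \<open>v\<close> or \<open>v + 1\<close>. If \<open>v + 1\<close> occurs, that entry is
  \<open>v\<close> by \<open>slow_hd_filter\<close>; otherwise no East step is drawn at all.\<close>

lemma ends_North_draw_rev:
  assumes "slow (x # a)" and "x < v"
  shows "ends_North (draw (v + 1) v (rev a))"
proof (cases "v + 1 \<in> set a")
  case True
  then have "hd (filter (\<lambda>w. w = v \<or> w = v + 1) a) = v"
    using slow_hd_filter[OF assms(1), of "v + 1"] assms(2) by simp
  moreover have "filter (\<lambda>w. w = v \<or> w = v + 1) a \<noteq> []" using True by (auto simp: filter_empty_conv)
  ultimately show ?thesis
    by (simp add: ends_North_def draw_eq_map_filter rev_filter[symmetric] last_map last_rev disj_commute)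
next
  case False
  have "last (draw (v + 1) v (rev a)) \<noteq> East" if "draw (v + 1) v (rev a) \<noteq> []"
  proof
    assume "last (draw (v + 1) v (rev a)) = East"
    then have "East \<in> set (draw (v + 1) v (rev a))" using that last_in_set by metis
    then show False using False count_draw_East[of "v + 1" v "rev a"]
      by (metis count_list_0_iff set_rev)
  qed
  then show ?thesis unfolding ends_North_def by (metis step.exhaust)
qed

lemma draw_map_uminus: "draw (- e) (- m) (map uminus a) = draw e m a"
  by (induction a) (auto simp: draw_def)

text \<open>Reversing and negating exchanges the two halves of a round, so facts about right-to-left
  readings transfer to left-to-right ones.\<close>

lemma slow_map_uminus_rev: "slow (map uminus (rev a)) \<longleftrightarrow> slow a"
  by (simp add: successively_map successively_rev) (simp add: algebra_simps)

text \<open>Under negation and reversal the sentinel 1 becomes a leading \<open>- 1\<close>, which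
  lies below every \<open>i \<ge> 0\<close>. The sentinel 0 only lies below
  \<open>i \<ge> 1\<close>, so the final half-round is left out.\<close>

lemma ends_North_draws:
  assumes "slow (0 # a @ [1])"
  shows "0 \<le> i \<Longrightarrow> ends_North (draw (- i - 1) (- i) a)"
    and "1 \<le> i \<Longrightarrow> ends_North (draw (i + 1) i (rev a))"
proof -
  let ?r = "map uminus (rev a)"
  assume "0 \<le> i"
  have "slow (- 1 # ?r)"
    using assms slow_map_uminus_rev[of "a @ [1]"] by (cases a) (auto simp: successively_Cons)
  from ends_North_draw_rev[OF this, of i] \<open>0 \<le> i\<close> have "ends_North (draw (i + 1) i (rev ?r))"
    by simp
  then show "ends_North (draw (- i - 1) (- i) a)"
    using draw_map_uminus[of "- i - 1" "- i" a] by (simp add: rev_map add.commute)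
next
  assume "1 \<le> i"
  have "slow (0 # a)" using assms by (metis append_Cons successively_append_iff)
  from ends_North_draw_rev[OF this, of i] \<open>1 \<le> i\<close>
  show "ends_North (draw (i + 1) i (rev a))" by simp
qed

text \<open>Two peelings, first of the right-to-left half and then of the left-to-right half. Only
  what precedes a peeled half must end with North, so \<open>i = 0\<close> is allowed.\<close>

lemma zeta_round_peel:
  assumes "U @ zeta_round a i = U' @ zeta_round b i"
    and "slow (0 # a @ [1])" and "slow (0 # b @ [1])" and "0 \<le> i"
    and "ends_North U" and "ends_North U'"
    and "count_list a i = count_list b i" and "count_list a (- i) = count_list b (- i)"
  shows "U = U' \<and> draw (- i - 1) (- i) a = draw (- i - 1) (- i) b \<and>
    draw (i + 1) i (rev a) = draw (i + 1) i (rev b)"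
proof -
  have "U @ draw (- i - 1) (- i) a = U' @ draw (- i - 1) (- i) b \<and>
      draw (i + 1) i (rev a) = draw (i + 1) i (rev b)"
    using assms by (intro peel_suffix) (auto simp: zeta_round_def ends_North_append ends_North_draws)
  moreover from this have "U = U' \<and> draw (- i - 1) (- i) a = draw (- i - 1) (- i) b"
    using assms by (intro peel_suffix) auto
  ultimately show ?thesis by simp
qed

lemma ends_North_zeta_round:
  "slow (0 # a @ [1]) \<Longrightarrow> 1 \<le> i \<Longrightarrow> ends_North (zeta_round a i)"
  by (simp add: zeta_round_def ends_North_append ends_North_draws)

text \<open>Decoding runs from the end of the path: the round \<open>i\<close> reveals how many entries equal
  \<open>i + 1\<close> and \<open>- i - 1\<close>, hence the numbers of North steps in the two halves of round \<open>i + 1\<close>.\<close>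

lemma zeta_rounds_peel:
  assumes "slow (0 # a @ [1])" and "slow (0 # b @ [1])" and "count_list a 0 = count_list b 0"
    and "U @ zeta_rounds n a = U' @ zeta_rounds n b" and "ends_North U" and "ends_North U'"
  shows "U = U' \<and> (\<forall>i\<in>{0..int n}. draw (- i - 1) (- i) a = draw (- i - 1) (- i) b \<and>
    draw (i + 1) i (rev a) = draw (i + 1) i (rev b))"
  using assms(4-6)
proof (induction n arbitrary: U U')
  case 0
  then show ?case
    using zeta_round_peel[of U a 0 U' b] assms(1-3) by (simp add: zeta_rounds_0)
next
  case (Suc n)
  let ?i = "int n + 1"
  \<comment> \<open>Round \<open>n + 1\<close> joins the unknown prefix; its index is at least 1, so
    the prefix still ends with North.\<close>
  have "(U @ zeta_round a ?i) @ zeta_rounds n a = (U' @ zeta_round b ?i) @ zeta_rounds n b"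
    using Suc.prems(1) by (simp add: zeta_rounds_Suc add.commute)
  then have IH: "U @ zeta_round a ?i = U' @ zeta_round b ?i"
    "\<And>i. i \<in> {0..int n} \<Longrightarrow> draw (- i - 1) (- i) a = draw (- i - 1) (- i) b \<and>
      draw (i + 1) i (rev a) = draw (i + 1) i (rev b)"
    using Suc.IH[of "U @ zeta_round a ?i" "U' @ zeta_round b ?i"] Suc.prems assms(1,2)
    by (auto simp: ends_North_append ends_North_zeta_round)
  have "count_list a (int n + 1) = count_list b (int n + 1)"
    using IH(2)[of "int n"] count_draw_East[of "int n + 1" "int n" "rev a"]
      count_draw_East[of "int n + 1" "int n" "rev b"] by simp
  moreover have "count_list a (- ?i) = count_list b (- ?i)"
    using IH(2)[of "int n"] count_draw_East[of "- int n - 1" "- int n" a]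
      count_draw_East[of "- int n - 1" "- int n" b] by simp
  ultimately have "U = U' \<and> draw (- ?i - 1) (- ?i) a = draw (- ?i - 1) (- ?i) b \<and>
    draw (?i + 1) ?i (rev a) = draw (?i + 1) ?i (rev b)"
    using IH(1) assms(1,2) Suc.prems(2,3) by (intro zeta_round_peel) auto
  moreover have "i = ?i \<or> i \<in> {0..int n}" if "i \<in> {0..int (Suc n)}" for i
    using that by auto
  ultimately show ?case using IH(2) by blast
qed

text \<open>The sum telescopes. The factor 2 arises because both halves of round 0 draw a North step
  for each zero.\<close>

lemma net_zeta_rounds:
  "net (zeta_rounds n a) = 2 * int (count_list a 0)
     - int (count_list a (int n + 1)) - int (count_list a (- int n - 1))"
proof (induction n)
  case 0
  then show ?case by (simp add: zeta_rounds_0 net_zeta_round)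
next
  case (Suc n)
  then show ?case
    unfolding zeta_rounds_Suc net_simps net_zeta_round minus_int_Suc by (simp add: add.commute)
qed

lemma count_list_out_of_bounds:
  assumes "\<forall>x\<in>set a. \<bar>x\<bar> \<le> int n" and "\<bar>v\<bar> > int n"
  shows "count_list a v = 0"
  using assms by (auto simp: count_list_0_iff)

lemma zeta_rounds_inject:
  assumes slow: "slow (0 # a @ [1])" "slow (0 # b @ [1])"
    and bounds: "\<forall>x\<in>set a. \<bar>x\<bar> \<le> int n" "\<forall>x\<in>set b. \<bar>x\<bar> \<le> int n"
    and eq: "zeta_rounds n a = zeta_rounds n b"
  shows "a = b"
proof (rule slow_eq_if_adjacent_filters_eq)
  show "slow a" "slow b" using slow by (auto simp: successively_Cons successively_append_iff)
  have "count_list a 0 = count_list b 0"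
    using net_zeta_rounds[of n a] net_zeta_rounds[of n b] eq
      count_list_out_of_bounds[OF bounds(1)] count_list_out_of_bounds[OF bounds(2)] by simp
  then have draws: "draw (- i - 1) (- i) a = draw (- i - 1) (- i) b \<and>
      draw (i + 1) i (rev a) = draw (i + 1) i (rev b)" if "i \<in> {0..int n}" for i
    using zeta_rounds_peel[OF slow, of "[]" n "[]"] eq that by (auto simp: ends_North_def)
  fix v
  \<comment> \<open>Adjacent pairs are read off the right-to-left halves, off the left-to-right
    halves, or lie outside the range of the entries.\<close>
  consider "v \<in> {0..int n}" | "- v - 1 \<in> {0..int n}" | "v > int n" | "v < - int n - 1"
    by fastforce
  then show "filter (\<lambda>w. w = v \<or> w = v + 1) a = filter (\<lambda>w. w = v \<or> w = v + 1) b"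
  proof cases
    case 1
    then have "filter (\<lambda>w. w = v + 1 \<or> w = v) (rev a) = filter (\<lambda>w. w = v + 1 \<or> w = v) (rev b)"
      using draws by (intro draw_eqD) auto
    then show ?thesis by (simp add: rev_filter[symmetric] disj_commute)
  next
    case 2
    then show ?thesis using draws[OF 2] by (intro draw_eqD) (auto simp: add.commute)
  next
    case 3
    then have "filter (\<lambda>w. w = v \<or> w = v + 1) a = []" "filter (\<lambda>w. w = v \<or> w = v + 1) b = []"
      using bounds by (fastforce simp: filter_empty_conv)+
    then show ?thesis by simp
  next
    case 4
    then have "filter (\<lambda>w. w = v \<or> w = v + 1) a = []" "filter (\<lambda>w. w = v \<or> w = v + 1) b = []"
      using bounds by (fastforce simp: filter_empty_conv)+
    then show ?thesis by simp
  qed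
qed

section \<open>Bijectivity from injectivity and equal cardinalities\<close>

lemma zeta_C_eq_zeta_rounds:
  "\<pi> \<in> lattice_paths n \<Longrightarrow> zeta_C n \<pi> = zeta_rounds n (area_vector \<pi>)"
  by (simp add: zeta_C_def length_zeta_rounds)

lemma bij_betw_zeta_C: "bij_betw (zeta_C n) (lattice_paths n) (ballot_paths n)"
proof -
  have inj: "inj_on (zeta_C n) (lattice_paths n)"
  proof (rule inj_onI)
    fix p q assume p: "p \<in> lattice_paths n" and q: "q \<in> lattice_paths n"
      and eq: "zeta_C n p = zeta_C n q"
    have "area_vector p = area_vector q"
      using p q eq
      by (intro zeta_rounds_inject[of _ _ n])
        (auto simp: slow_area_vector zeta_C_eq_zeta_rounds area_vector_bounds)
    then show "p = q" using inj_onD[OF inj_on_area_vector] p q by blast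
  qed
  have "zeta_C n ` lattice_paths n \<subseteq> ballot_paths n"
  proof
    fix \<beta> assume "\<beta> \<in> zeta_C n ` lattice_paths n"
    then obtain \<pi> where \<pi>: "\<pi> \<in> lattice_paths n" and \<beta>: "\<beta> = zeta_rounds n (area_vector \<pi>)"
      by (auto simp: zeta_C_eq_zeta_rounds)
    have "count_list (area_vector \<pi>) v = 0" if "\<bar>v\<bar> > int n" for v
      using count_list_out_of_bounds[OF _ that] area_vector_bounds[OF \<pi>] by blast
    then have "stays 0 \<beta>" using stays_zeta_rounds[of "area_vector \<pi>" n] \<beta> by simp
    then show "\<beta> \<in> ballot_paths n" using \<beta> \<pi> by (simp add: ballot_paths_eq_stays length_zeta_rounds)
  qed
  moreover have "finite (ballot_paths n)"
    unfolding ballot_paths_def by (rule finite_paths_length)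
  ultimately have "zeta_C n ` lattice_paths n = ballot_paths n"
    using card_image[OF inj] card_ballot_paths by (intro card_subset_eq) auto
  then show ?thesis using inj by (simp add: bij_betw_def)
qed

section \<open>Area as a sum over East steps\<close>

text \<open>An East step drawn at height \<open>h\<close> above the diagonal has \<open>h - 1\<close> boxes below it.\<close>

fun east_sum :: "int \<Rightarrow> path \<Rightarrow> int" where
  "east_sum h [] = 0"
| "east_sum h (North # p) = east_sum (h + 1) p"
| "east_sum h (East # p) = (h - 1) + east_sum (h - 1) p"

lemma east_sum_append: "east_sum h (p @ q) = east_sum h p + east_sum (h + net p) q"
  by (induction h p rule: east_sum.induct) (simp_all add: algebra_simps)

lemma north_xs_append: "north_xs x (p @ q) = north_xs x p @ north_xs (x + count_list p East) q"
  by (induction x p rule: north_xs.induct) auto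

text \<open>Induction on the last step: a North step adds no box in these columns, and an East step
  adds a column of \<open>height - 1\<close> boxes.\<close>

lemma card_boxes_left_of_end:
  assumes "stays 0 p"
  shows "int (card {(i, j). 1 \<le> i \<and> i < j \<and> i \<le> count_list p East \<and> j \<le> count_list p North
    \<and> north_xs 0 p ! (j - 1) \<le> i - 1}) = east_sum 0 p"
  using assms
proof (induction p rule: rev_induct)
  case Nil
  have "{(i :: nat, j). 1 \<le> i \<and> i < j \<and> i \<le> count_list [] East \<and> j \<le> count_list [] North
    \<and> north_xs 0 [] ! (j - 1) \<le> i - 1} = {}" by auto
  then show ?case by (simp only: card.empty) simp
next
  case (snoc s p)
  let ?e = "count_list p East" and ?m = "count_list p North" and ?b = "north_xs 0 p"
  let ?S = "\<lambda>p. {(i, j). 1 \<le> i \<and> i < j \<and> i \<le> count_list p East \<and> j \<le> count_list p North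
    \<and> north_xs 0 p ! (j - 1) \<le> i - 1}"
  have stays: "stays 0 p" "stays (nat (net p)) [s]" using snoc.prems by (auto simp: stays_append)
  have IH: "int (card (?S p)) = east_sum 0 p" using snoc.IH stays by blast
  have len: "length ?b = ?m" by (rule length_north_xs)
  have fin: "finite (?S p)" by (rule finite_subset[of _ "{..?e} \<times> {..?m}"]) auto
  show ?case
  proof (cases s)
    case North
    \<comment> \<open>The new North step has abscissa \<open>?e\<close>, so its boxes lie in columns
      beyond \<open>?e\<close>.\<close>
    have "?S (p @ [s]) = ?S p"
      using North len by (auto simp: north_xs_append nth_append le_Suc_eq split: if_splits)
    then show ?thesis using IH North by (simp add: east_sum_append)
  next
    case East
    have "?b ! (j - 1) \<le> ?e" if "1 \<le> j" "j \<le> ?m" for j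
      using north_xs_le[of "?b ! (j - 1)" 0 p] that len by simp
    then have "?S (p @ [s]) = ?S p \<union> Pair (Suc ?e) ` {Suc ?e<..?m}"
      using East by (auto simp: north_xs_append le_Suc_eq image_iff)
    moreover have "?S p \<inter> Pair (Suc ?e) ` {Suc ?e<..?m} = {}" by auto
    ultimately have "card (?S (p @ [s])) = card (?S p) + (?m - Suc ?e)"
      using fin by (simp add: card_Un_disjoint card_image inj_on_def)
    \<comment> \<open>This makes the truncated subtraction \<open>?m - Suc ?e\<close> exact.\<close>
    moreover have "?m \<ge> Suc ?e" using stays(2) East by (auto simp: net_def)
    ultimately show ?thesis using IH East by (simp add: east_sum_append net_def of_nat_diff)
  qed
qed

lemma sum_odd: "(\<Sum>k<z. 2 * k + 1) = z ^ 2" for z :: nat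
  by (induction z) (simp_all add: power2_eq_square)

text \<open>Column \<open>e + z - k\<close> contains \<open>2 * k + 1\<close> boxes for
  \<open>k < z\<close>, and the odd numbers sum to a square.\<close>

lemma card_triangle:
  "card {(i, j). e < i \<and> i < j \<and> i + j \<le> 2 * e + 2 * z + 1} = z ^ 2" for e z :: nat
proof -
  have "{(i, j). e < i \<and> i < j \<and> i + j \<le> 2 * e + 2 * z + 1} =
      (\<lambda>(k, j). (e + z - k, j)) ` (SIGMA k:{..<z}. {e + z - k + 1..e + z + k + 1})"
    (is "?L = ?f ` ?R")
  proof
    show "?L \<subseteq> ?f ` ?R"
    proof
      fix x assume "x \<in> ?L"
      then obtain i j where x: "x = (i, j)" "e < i" "i < j" "i + j \<le> 2 * e + 2 * z + 1" by auto
      then have "x = ?f (e + z - i, j)" "(e + z - i, j) \<in> ?R" by auto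
      then show "x \<in> ?f ` ?R" by blast
    qed
  qed auto
  moreover have "inj_on ?f ?R" by (auto simp: inj_on_def)
  ultimately have "card ?L = (\<Sum>k<z. card {e + z - k + 1..e + z + k + 1})"
    by (simp add: card_image)
  also have "\<dots> = (\<Sum>k<z. 2 * k + 1)" by (rule sum.cong) auto
  finally show ?thesis by (simp only: sum_odd)
qed

text \<open>The endpoint is \<open>(e, e + 2 * z)\<close> with \<open>n = e + z\<close>. Up to
  column \<open>e\<close> the bound on \<open>i + j\<close> is automatic; beyond it, both conditions
  on the \<open>j\<close>-th North step are automatic.\<close>

lemma ballot_area_eq_east_sum:
  assumes "length \<beta> = 2 * n" and "stays 0 \<beta>" and "net \<beta> = 2 * int z"
  shows "int (ballot_area n \<beta>) = int z ^ 2 + east_sum 0 \<beta>"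
proof -
  let ?e = "count_list \<beta> East" and ?m = "count_list \<beta> North" and ?b = "north_xs 0 \<beta>"
  have m: "?m = ?e + 2 * z" using assms(3) by (simp add: net_def)
  have n: "n = ?e + z" using assms(1) m by (simp add: length_eq_count_steps)
  have len: "length ?b = ?m" by (rule length_north_xs)
  have b: "?b ! (j - 1) \<le> ?e" if "1 \<le> j" "j \<le> ?m" for j
    using north_xs_le[of "?b ! (j - 1)" 0 \<beta>] that len by simp
  let ?L = "{(i, j). 1 \<le> i \<and> i < j \<and> i \<le> ?e \<and> j \<le> ?m \<and> ?b ! (j - 1) \<le> i - 1}"
  let ?T = "{(i, j). ?e < i \<and> i < j \<and> i + j \<le> 2 * ?e + 2 * z + 1}"
  have "{(i, j). 1 \<le> i \<and> i < j \<and> i + j \<le> 2 * n + 1 \<and> j \<le> length ?b \<and> ?b ! (j - 1) \<le> i - 1}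
      = ?L \<union> ?T" (is "?A = _")
  proof (intro subset_antisym subsetI)
    fix x assume "x \<in> ?A"
    then show "x \<in> ?L \<union> ?T" using m n len by auto
  next
    fix x assume "x \<in> ?L \<union> ?T"
    then show "x \<in> ?A"
    proof
      assume "x \<in> ?L"
      then show ?thesis using m n len by auto
    next
      assume "x \<in> ?T"
      then obtain i j where x: "x = (i, j)" "?e < i" "i < j" "i + j \<le> 2 * ?e + 2 * z + 1" by auto
      then have "?b ! (j - 1) \<le> i - 1" using b[of j] m by simp
      then show ?thesis using x m n len by auto
    qed
  qed
  moreover have "finite ?L" by (rule finite_subset[of _ "{..?e} \<times> {..?m}"]) auto
  moreover have "finite ?T"
    by (rule finite_subset[of _ "{..2 * ?e + 2 * z + 1} \<times> {..2 * ?e + 2 * z + 1}"]) auto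
  moreover have "?L \<inter> ?T = {}" by auto
  ultimately have "ballot_area n \<beta> = card ?L + card ?T"
    by (simp only: ballot_area_def Let_def card_Un_disjoint)
  then show ?thesis using card_boxes_left_of_end[OF assms(2)] card_triangle[of ?e z]
    by simp
qed

section \<open>Counting pairs of entries\<close>

fun pair_count :: "('a \<Rightarrow> 'a \<Rightarrow> bool) \<Rightarrow> 'a list \<Rightarrow> nat" where
  "pair_count R [] = 0"
| "pair_count R (x # xs) = length (filter (R x) xs) + pair_count R xs"

lemma card_pairs_eq_pair_count:
  "card {(i, j). i < j \<and> j < length a \<and> R (a ! i) (a ! j)} = pair_count R a"
proof (induction a)
  case Nil
  then show ?case by simp
next
  case (Cons x a)
  let ?S = "{(i, j). i < j \<and> j < length a \<and> R (a ! i) (a ! j)}"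
  let ?H = "{j. j < length a \<and> R x (a ! j)}"
  let ?f = "\<lambda>(i, j). (Suc i, Suc j)" and ?g = "\<lambda>j. (0 :: nat, Suc j)"
  have fin: "finite ?H" by simp
  have "{(i, j). i < j \<and> j < length (x # a) \<and> R ((x # a) ! i) ((x # a) ! j)} = ?g ` ?H \<union> ?f ` ?S"
    (is "?A = ?B")
  proof
    show "?A \<subseteq> ?B"
    proof
      fix u assume "u \<in> ?A"
      then obtain i j where u: "u = (i, Suc j)" "i < Suc j" "j < length a" "R ((x # a) ! i) (a ! j)"
        by (auto simp: gr0_conv_Suc elim!: less_natE)
      show "u \<in> ?B"
      proof (cases i)
        case 0
        then show ?thesis using u by auto
      next
        case (Suc k)
        then have "(k, j) \<in> ?S" using u by auto
        then show ?thesis using u Suc by (intro UnI2) (auto simp: image_iff)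
      qed
    qed
  qed auto
  moreover have "finite ?S" by (rule finite_subset[of _ "{..<length a} \<times> {..<length a}"]) auto
  moreover have "?g ` ?H \<inter> ?f ` ?S = {}" by auto
  moreover have "inj_on ?g ?H" "inj_on ?f ?S" by (auto simp: inj_on_def)
  ultimately have "card ?A = card ?H + card ?S"
    by (simp only: card_Un_disjoint finite_imageI fin card_image)
  then show ?case using Cons.IH by (simp add: length_filter_conv_card)
qed

lemma length_filter_eq_count_list:
  "(\<And>y. P y \<longleftrightarrow> y = v) \<Longrightarrow> length (filter P a) = count_list a v"
  by (induction a) auto

definition list_dinv :: "int list \<Rightarrow> nat" where
  "list_dinv a = pair_count (=) a + pair_count (\<lambda>x y. x = y + 1) a
     + pair_count (\<lambda>x y. x = - y) a + pair_count (\<lambda>x y. x = - y + 1) a + count_list a 0"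

lemma dinv_eq_list_dinv: "dinv \<pi> = list_dinv (area_vector \<pi>)"
proof -
  have "card {i. i < length a \<and> a ! i = 0} = count_list a 0" for a :: "int list"
    using length_filter_conv_card[of "\<lambda>y. y = 0" a] length_filter_eq_count_list[of "\<lambda>y. y = 0" 0 a]
    by simp
  then show ?thesis
    unfolding dinv_def list_dinv_def Let_def card_pairs_eq_pair_count[symmetric] by simp
qed

lemma list_dinv_Cons:
  "list_dinv (x # a) = list_dinv a + count_list a x + count_list a (x - 1)
     + count_list a (- x) + count_list a (1 - x) + (if x = 0 then 1 else 0)"
proof -
  have "length (filter ((=) x) a) = count_list a x"
    "length (filter (\<lambda>y. x = y + 1) a) = count_list a (x - 1)"
    "length (filter (\<lambda>y. x = - y) a) = count_list a (- x)"
    "length (filter (\<lambda>y. x = - y + 1) a) = count_list a (1 - x)"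
    by (rule length_filter_eq_count_list, auto)+
  then show ?thesis by (simp add: list_dinv_def)
qed

text \<open>The number of pairs of a North step and a later East step.\<close>

fun north_east :: "path \<Rightarrow> nat" where
  "north_east [] = 0"
| "north_east (North # p) = count_list p East + north_east p"
| "north_east (East # p) = north_east p"

lemma north_east_append:
  "north_east (p @ q) = north_east p + north_east q + count_list p North * count_list q East"
  by (induction p rule: north_east.induct) auto

text \<open>The \<open>k\<close>-th East step contributes \<open>h - k\<close> plus the number of
  North steps before it.\<close>

lemma two_east_sum:
  "2 * east_sum h p = 2 * h * int (count_list p East)
     - int (count_list p East) * (int (count_list p East) + 1) + 2 * int (north_east p)"
  by (induction h p rule: east_sum.induct) (simp_all add: algebra_simps)

lemma draw_Nil: "draw e m [] = []"
  by (simp add: draw_def)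

lemma draw_Cons:
  "draw e m (x # a) = (if x = e then [East] else if x = m then [North] else []) @ draw e m a"
  by (simp add: draw_def)

lemma draw_append: "draw e m (a @ b) = draw e m a @ draw e m b"
  by (simp add: draw_def)

lemma north_east_draw:
  assumes "e \<noteq> m"
  shows "north_east (draw e m a) = pair_count (\<lambda>x y. x = m \<and> y = e) a"
proof (induction a)
  case (Cons x a)
  have "length (filter (\<lambda>y. y = e) a) = count_list a e"
    by (rule length_filter_eq_count_list) simp
  then show ?case using Cons assms by (auto simp: draw_Cons)
qed (simp add: draw_Nil)

lemma north_east_draw_rev:
  assumes "e \<noteq> m"
  shows "north_east (draw e m (rev a)) = pair_count (\<lambda>x y. x = e \<and> y = m) a"
proof (induction a)
  case (Cons x a)
  have "length (filter (\<lambda>y. y = m) a) = count_list a m"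
    by (rule length_filter_eq_count_list) simp
  then show ?case
    using Cons assms by (auto simp: draw_append draw_Cons draw_Nil north_east_append)
qed (simp add: draw_Nil)

section \<open>Dinv and area\<close>

text \<open>Contributions are doubled so that the binomial coefficients \<open>c choose 2\<close> need no division.\<close>

definition round_area :: "int list \<Rightarrow> int \<Rightarrow> int" where
  "round_area a i = (let c = \<lambda>v. int (count_list a v) in
     2 * c (- i - 1) * c (i + 1) + 2 * c (- i) * c (i + 1)
     + c (- i - 1) * (c (- i - 1) - 1) + c (i + 1) * (c (i + 1) - 1)
     + 2 * int (pair_count (\<lambda>x y. x = - i \<and> y = - i - 1) a)
     + 2 * int (pair_count (\<lambda>x y. x = i + 1 \<and> y = i) a))"

text \<open>Apply \<open>two_east_sum\<close> to each half; the second starts at height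
  \<open>count_list a (i + 1) + count_list a (- i)\<close>.\<close>

lemma two_east_sum_zeta_round:
  "2 * east_sum (int (count_list a (i + 1)) + int (count_list a (- i - 1))) (zeta_round a i)
     = round_area a i"
  unfolding zeta_round_def east_sum_append distrib_left two_east_sum round_area_def Let_def
  by (simp add: north_east_draw[of _ _ a] north_east_draw_rev net_def) (simp add: algebra_simps)

lemma two_east_sum_zeta_rounds:
  "2 * east_sum (int (count_list a (int n + 1)) + int (count_list a (- int n - 1))) (zeta_rounds n a)
     = (\<Sum>i\<le>n. round_area a (int i))"
proof (induction n)
  case 0
  then show ?case using two_east_sum_zeta_round[of a 0] by (simp add: zeta_rounds_0)
next
  case (Suc n)
  let ?h = "int (count_list a (int (Suc n) + 1)) + int (count_list a (- int (Suc n) - 1))"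
  have h: "?h + net (zeta_round a (int (Suc n)))
      = int (count_list a (int n + 1)) + int (count_list a (- int n - 1))"
    unfolding net_zeta_round minus_int_Suc by (simp add: add.commute)
  show ?case
    unfolding zeta_rounds_Suc east_sum_append h distrib_left Suc.IH two_east_sum_zeta_round
    by simp
qed

text \<open>For \<open>0 \<le> i\<close> the values \<open>i + 1\<close>, \<open>- i - 1\<close> and
  \<open>- i\<close> are distinct, so at most one correction applies.\<close>

lemma round_area_Cons:
  assumes "0 \<le> i"
  shows "round_area (x # a) i = round_area a i
     + (if x = i + 1 then 2 * (int (count_list a (i + 1)) + int (count_list a (- i - 1))
          + int (count_list a (- i)) + int (count_list a i)) else 0)
     + (if x = - i - 1 then 2 * (int (count_list a (- i - 1)) + int (count_list a (i + 1))) else 0)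
     + (if x = - i then 2 * (int (count_list a (i + 1)) + int (count_list a (- i - 1))) else 0)"
proof -
  have "length (filter (\<lambda>y. y = v) a) = count_list a v"
    "length (filter (\<lambda>y. y + 1 = v) a) = count_list a (v - 1)" for v
    by (rule length_filter_eq_count_list, auto)+
  then show ?thesis
    using assms by (auto simp: round_area_def Let_def algebra_simps)
qed

text \<open>Prepending \<open>x\<close> must change both sides equally. A positive \<open>x\<close>
  affects only round \<open>x - 1\<close>, zero affects round 0 and the square, and a negative
  \<open>x\<close> affects rounds \<open>- x - 1\<close> and \<open>- x\<close>.\<close>

lemma two_list_dinv:
  assumes "\<forall>x\<in>set a. \<bar>x\<bar> \<le> int n"
  shows "2 * int (list_dinv a) = 2 * int (count_list a 0) ^ 2 + (\<Sum>i\<le>n. round_area a (int i))"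
  using assms
proof (induction a)
  case Nil
  then show ?case by (simp add: list_dinv_def round_area_def)
next
  case (Cons x a)
  let ?c = "\<lambda>v. int (count_list a v)"
  have IH: "2 * int (list_dinv a) = 2 * ?c 0 ^ 2 + (\<Sum>i\<le>n. round_area a (int i))"
    using Cons by simp
  have sum: "(\<Sum>i\<le>n. round_area (x # a) (int i)) = (\<Sum>i\<le>n. round_area a (int i))
     + (\<Sum>i\<le>n. if x = int i + 1
          then 2 * (?c (int i + 1) + ?c (- int i - 1) + ?c (- int i) + ?c (int i)) else 0)
     + (\<Sum>i\<le>n. if x = - int i - 1 then 2 * (?c (- int i - 1) + ?c (int i + 1)) else 0)
     + (\<Sum>i\<le>n. if x = - int i then 2 * (?c (int i + 1) + ?c (- int i - 1)) else 0)"
    by (simp only: round_area_Cons of_nat_0_le_iff sum.distrib)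
  consider k where "x = int (Suc k)" | "x = 0" | k where "x = - int (Suc k)"
    by (metis int_cases3 gr0_conv_Suc)
  then show ?case
  proof cases
    case 1
    have "x = int i + 1 \<longleftrightarrow> k = i" "x \<noteq> - int i - 1" "x \<noteq> - int i" for i
      using 1 by auto
    moreover have "k \<le> n" using Cons.prems 1 by simp
    ultimately show ?thesis
      unfolding sum list_dinv_Cons using IH 1 by (simp add: algebra_simps minus_diff_commute)
  next
    case 2
    \<comment> \<open>The square grows by \<open>2 * ?c 0 + 1\<close>: zeros are paired by both
      \<open>x = y\<close> and \<open>x = - y\<close>, and the new zero counts by itself.\<close>
    have "x \<noteq> int i + 1" "x \<noteq> - int i - 1" "x = - int i \<longleftrightarrow> 0 = i" for i
      using 2 by auto
    then show ?thesis
      unfolding sum list_dinv_Cons using IH 2 by (simp add: algebra_simps power2_eq_square)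
  next
    case 3
    \<comment> \<open>Round \<open>k\<close> accounts for the later entries \<open>x\<close> and
      \<open>- x\<close>, round \<open>k + 1\<close> for \<open>x - 1\<close> and
      \<open>1 - x\<close>.\<close>
    have conds: "x = int i + 1 \<longleftrightarrow> False" "x = - int i - 1 \<longleftrightarrow> k = i" "x = - int i \<longleftrightarrow> Suc k = i" for i
      using 3 by auto
    have "k \<le> n" "Suc k \<le> n" using Cons.prems 3 by simp_all
    then have deltas: "(\<Sum>i\<le>n. if k = i then f i else 0) = f k"
      "(\<Sum>i\<le>n. if Suc k = i then f i else 0) = f (Suc k)" for f :: "nat \<Rightarrow> int"
      by simp_all
    have args: "- int k - 1 = x" "int k + 1 = - x" "- int (Suc k) - 1 = x - 1"
      "int (Suc k) + 1 = 1 - x" and "x \<noteq> 0"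
      using 3 by auto
    then show ?thesis
      unfolding sum list_dinv_Cons conds deltas args using IH by simp
  qed
qed

lemma dinv_eq_ballot_area:
  assumes "\<pi> \<in> lattice_paths n"
  shows "dinv \<pi> = ballot_area n (zeta_C n \<pi>)"
proof -
  let ?a = "area_vector \<pi>" and ?\<beta> = "zeta_rounds n (area_vector \<pi>)"
  have bounds: "\<forall>x\<in>set ?a. \<bar>x\<bar> \<le> int n" using area_vector_bounds[OF assms] by blast
  have zero: "count_list ?a (int n + 1) = 0" "count_list ?a (- int n - 1) = 0"
    using count_list_out_of_bounds[OF bounds] by simp_all
  have "stays 0 ?\<beta>" using stays_zeta_rounds[of ?a n] zero by simp
  moreover have "net ?\<beta> = 2 * int (count_list ?a 0)" using net_zeta_rounds[of n ?a] zero by simp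
  ultimately have "int (ballot_area n ?\<beta>) = int (count_list ?a 0) ^ 2 + east_sum 0 ?\<beta>"
    using length_zeta_rounds[OF assms] by (intro ballot_area_eq_east_sum)
  moreover have "2 * east_sum 0 ?\<beta> = (\<Sum>i\<le>n. round_area ?a (int i))"
    using two_east_sum_zeta_rounds[of ?a n] zero by simp
  ultimately have "int (dinv \<pi>) = int (ballot_area n ?\<beta>)"
    using two_list_dinv[OF bounds] by (simp add: dinv_eq_list_dinv)
  then show ?thesis using assms by (simp add: zeta_C_eq_zeta_rounds)
qed

theorem theorem4p1:
  fixes n :: nat
  assumes "n \<ge> 1"
  shows "bij_betw (zeta_C n) (lattice_paths n) (ballot_paths n) \<and>
         (\<forall>\<pi> \<in> lattice_paths n. dinv \<pi> = ballot_area n (zeta_C n \<pi>))"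
  using bij_betw_zeta_C dinv_eq_ballot_area by blast

end
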